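(* Let $\alpha,\beta\in\mathbb{R}$ with $\alpha\neq 0$. Let $G_1$ be the connected, simply connected three-dimensional Lie group with left-invariant Lorentzian metric $g$ whose Lie algebra has a pseudo-orthonormal basis $\{e_1,e_2,e_3\}$, $e_3$ timelike, with $$[e_1,e_2]=\alpha e_1-\beta e_3,\quad [e_1,e_3]=-\alpha e_1-\beta e_2,\quad [e_2,e_3]=\beta e_1+\alpha e_2+\alpha e_3.$$ Let $V=\lambda_1e_1+\lambda_2e_2+\lambda_3e_3$ with $\lambda_1,\lambda_2,\lambda_3\in\mathbb{R}$, and let $\lambda\in\mathbb{R}$. Then $(G_1,V,g)$ is a left-invariant Riemann soliton with constant $\lambda$ if and only if $$\lambda_1=2\beta,\quad \lambda_2=-2\alpha,\quad \lambda_3=-2\alpha,\quad \lambda=\frac{\beta^2}{4}.$$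
   Context: Elements of the Lie algebra are identified with left-invariant vector fields. A pseudo-orthonormal basis $\{e_1,e_2,e_3\}$ with $e_3$ timelike means $g(e_1,e_1)=g(e_2,e_2)=1$, $g(e_3,e_3)=-1$, and $g(e_i,e_j)=0$ for $i\ne j$. Let $\nabla$ be the Levi-Civita connection of $g$, with curvature $R(X,Y)Z=\nabla_X\nabla_YZ-\nabla_Y\nabla_XZ-\nabla_{[X,Y]}Z$, and set $R(X,Y,Z,W)=-g(R(X,Y)Z,W)$. For $(0,2)$-tensors $T_1,T_2$ the Kulkarni-Nomizu product is $$(T_1\wedge T_2)(X,Y,Z,W)=T_1(X,W)T_2(Y,Z)+T_1(Y,Z)T_2(X,W)-T_1(X,Z)T_2(Y,W)-T_1(Y,W)T_2(X,Z).$$ $L_Vg$ denotes the Lie derivative of $g$ along $V$. For a left-invariant vector field $V$ and a real constant $\lambda$, $(G,V,g)$ is a left-invariant Riemann soliton with constant $\lambda$ if $R+\frac12 L_Vg\wedge g=\frac{\lambda}{2}g\wedge g$, i.e. for all vector fields $X,Y,Z,W$, $$2R(X,Y,Z,W)+g(X,W)(L_Vg)(Y,Z)+g(Y,Z)(L_Vg)(X,W)-g(X,Z)(L_Vg)(Y,W)-g(Y,W)(L_Vg)(X,Z)=2\lambda[g(X,W)g(Y,Z)-g(X,Z)g(Y,W)].$$ *)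

theory Defs
  imports "HOL-Analysis.Analysis"
begin

section \<open>Smooth manifolds\<close>

primrec Ck_on :: "nat \<Rightarrow> 'a::real_normed_vector set \<Rightarrow> ('a \<Rightarrow> 'b::real_normed_vector) \<Rightarrow> bool" where
  "Ck_on 0 S f \<longleftrightarrow> continuous_on S f"
| "Ck_on (Suc k) S f \<longleftrightarrow> (\<forall>x\<in>S. f differentiable (at x)) \<and>
     (\<forall>v. Ck_on k S (\<lambda>x. frechet_derivative f (at x) v))"

text \<open>Only used for open \<open>S\<close>, where the unrestricted derivative \<open>at x\<close> depends on
  the values of \<open>f\<close> on \<open>S\<close> alone.\<close>

definition smooth_on :: "'a::real_normed_vector set \<Rightarrow> ('a \<Rightarrow> 'b::real_normed_vector) \<Rightarrow> bool" where
  "smooth_on S f \<longleftrightarrow> (\<forall>k. Ck_on k S f)"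

text \<open>A chart is a domain \<open>U\<close> with a coordinate map \<open>\<phi>\<close>; the values of \<open>\<phi>\<close> outside \<open>U\<close>
  are irrelevant. The manifold itself is the whole type, with its topology.\<close>

type_synonym ('a, 'n) chart = "'a set \<times> ('a \<Rightarrow> real ^ 'n)"

definition smooth_atlas :: "('a::{t2_space,second_countable_topology}, 'n::finite) chart set \<Rightarrow> bool" where
  "smooth_atlas A \<longleftrightarrow>
     (\<forall>p. \<exists>(U, \<phi>)\<in>A. p \<in> U) \<and>
     (\<forall>(U, \<phi>)\<in>A. open U \<and> open (\<phi> ` U) \<and> homeomorphism U (\<phi> ` U) \<phi> (inv_into U \<phi>)) \<and>
     (\<forall>(U, \<phi>)\<in>A. \<forall>(W, \<psi>)\<in>A. smooth_on (\<phi> ` (U \<inter> W)) (\<psi> \<circ> inv_into U \<phi>))"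

definition smooth_functions :: "('a, 'n::finite) chart set \<Rightarrow> ('a \<Rightarrow> real) set" where
  "smooth_functions A = {f. \<forall>(U, \<phi>)\<in>A. smooth_on (\<phi> ` U) (f \<circ> inv_into U \<phi>)}"

text \<open>A tangent vector at \<open>p\<close> is the operator on smooth functions that takes the derivative at
  \<open>p\<close> in some direction \<open>v\<close> of some chart around \<open>p\<close>. It is extended by \<open>0\<close> to functions
  that are not smooth, so that equality of operators is equality of tangent vectors.\<close>

type_synonym 'a tangent = "('a \<Rightarrow> real) \<Rightarrow> real"

definition tangent_space :: "('a, 'n::finite) chart set \<Rightarrow> 'a \<Rightarrow> 'a tangent set" where
  "tangent_space A p =
     {\<lambda>f. if f \<in> smooth_functions A
          then frechet_derivative (f \<circ> inv_into U \<phi>) (at (\<phi> p)) v else 0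
      | U \<phi> v. (U, \<phi>) \<in> A \<and> p \<in> U}"

type_synonym 'a vfield = "'a \<Rightarrow> 'a tangent"

definition vector_fields :: "('a, 'n::finite) chart set \<Rightarrow> 'a vfield set" where
  "vector_fields A = {X. (\<forall>p. X p \<in> tangent_space A p) \<and>
     (\<forall>f\<in>smooth_functions A. (\<lambda>p. X p f) \<in> smooth_functions A)}"

definition bracket :: "'a vfield \<Rightarrow> 'a vfield \<Rightarrow> 'a vfield" where
  "bracket X Y = (\<lambda>p f. X p (\<lambda>q. Y q f) - Y p (\<lambda>q. X q f))"


section \<open>Lie groups\<close>

text \<open>Continuity of the operations makes the coordinate domains below open.\<close>

definition lie_group ::
  "('a::{t2_space,second_countable_topology}, 'n::finite) chart set
     \<Rightarrow> ('a \<Rightarrow> 'a \<Rightarrow> 'a) \<Rightarrow> 'a \<Rightarrow> ('a \<Rightarrow> 'a) \<Rightarrow> bool" where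
  "lie_group A mul one inve \<longleftrightarrow>
     smooth_atlas A \<and> group mul one inve \<and>
     continuous_on UNIV (\<lambda>(x, y). mul x y) \<and> continuous_on UNIV inve \<and>
     (\<forall>(U, \<phi>)\<in>A. \<forall>(U', \<phi>')\<in>A. \<forall>(W, \<psi>)\<in>A.
        smooth_on {(\<phi> x, \<phi>' y) | x y. x \<in> U \<and> y \<in> U' \<and> mul x y \<in> W}
          (\<lambda>(a, b). \<psi> (mul (inv_into U \<phi> a) (inv_into U' \<phi>' b)))) \<and>
     (\<forall>(U, \<phi>)\<in>A. \<forall>(W, \<psi>)\<in>A.
        smooth_on (\<phi> ` {x \<in> U. inve x \<in> W}) (\<lambda>a. \<psi> (inve (inv_into U \<phi> a))))"

text \<open>The differential of left translation by \<open>a\<close>, on tangent vectors.\<close>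

definition push_left :: "('a \<Rightarrow> 'a \<Rightarrow> 'a) \<Rightarrow> 'a \<Rightarrow> 'a tangent \<Rightarrow> 'a tangent" where
  "push_left mul a u = (\<lambda>f. u (\<lambda>q. f (mul a q)))"

definition left_invariant_fields ::
  "('a, 'n::finite) chart set \<Rightarrow> ('a \<Rightarrow> 'a \<Rightarrow> 'a) \<Rightarrow> 'a vfield set" where
  "left_invariant_fields A mul =
     {X \<in> vector_fields A. \<forall>a p. X (mul a p) = push_left mul a (X p)}"


section \<open>Lorentzian metrics\<close>

type_synonym 'a metric = "'a \<Rightarrow> 'a tangent \<Rightarrow> 'a tangent \<Rightarrow> real"

text \<open>The last conjunct says that every \<open>g p\<close> has exactly one negative direction: some vector is
  timelike and \<open>g p\<close> is positive definite on its orthogonal complement.\<close>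

definition lorentzian_metric :: "('a, 'n::finite) chart set \<Rightarrow> 'a metric \<Rightarrow> bool" where
  "lorentzian_metric A g \<longleftrightarrow>
     (\<forall>p. \<forall>u\<in>tangent_space A p. \<forall>v\<in>tangent_space A p. g p u v = g p v u) \<and>
     (\<forall>p. \<forall>u\<in>tangent_space A p. \<forall>v\<in>tangent_space A p. \<forall>w\<in>tangent_space A p. \<forall>a b.
        g p (\<lambda>f. a * u f + b * v f) w = a * g p u w + b * g p v w) \<and>
     (\<forall>X\<in>vector_fields A. \<forall>Y\<in>vector_fields A. (\<lambda>p. g p (X p) (Y p)) \<in> smooth_functions A) \<and>
     (\<forall>p. \<forall>u\<in>tangent_space A p. (\<forall>w\<in>tangent_space A p. g p u w = 0) \<longrightarrow> u = (\<lambda>f. 0)) \<and>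
     (\<forall>p. \<exists>u\<in>tangent_space A p. g p u u < 0 \<and>
        (\<forall>w\<in>tangent_space A p. g p u w = 0 \<and> w \<noteq> (\<lambda>f. 0) \<longrightarrow> 0 < g p w w))"

definition left_invariant_metric ::
  "('a, 'n::finite) chart set \<Rightarrow> ('a \<Rightarrow> 'a \<Rightarrow> 'a) \<Rightarrow> 'a metric \<Rightarrow> bool" where
  "left_invariant_metric A mul g \<longleftrightarrow>
     (\<forall>a p. \<forall>u\<in>tangent_space A p. \<forall>v\<in>tangent_space A p.
        g (mul a p) (push_left mul a u) (push_left mul a v) = g p u v)"

definition metric_on_fields :: "'a metric \<Rightarrow> 'a vfield \<Rightarrow> 'a vfield \<Rightarrow> 'a \<Rightarrow> real" where
  "metric_on_fields g X Y = (\<lambda>p. g p (X p) (Y p))"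

definition lie_derivative_metric ::
  "'a metric \<Rightarrow> 'a vfield \<Rightarrow> 'a vfield \<Rightarrow> 'a vfield \<Rightarrow> 'a \<Rightarrow> real" where
  "lie_derivative_metric g V X Y = (\<lambda>p. V p (metric_on_fields g X Y)
     - metric_on_fields g (bracket V X) Y p - metric_on_fields g X (bracket V Y) p)"

text \<open>Three left-invariant fields forming a basis of the Lie algebra, with \<open>e3\<close> timelike.
  Linear independence over the reals is the uniqueness of the coefficients.\<close>

definition pseudo_orthonormal_basis ::
  "('a, 'n::finite) chart set \<Rightarrow> ('a \<Rightarrow> 'a \<Rightarrow> 'a) \<Rightarrow> 'a metric
     \<Rightarrow> 'a vfield \<Rightarrow> 'a vfield \<Rightarrow> 'a vfield \<Rightarrow> bool" where
  "pseudo_orthonormal_basis A mul g e1 e2 e3 \<longleftrightarrow>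
     {e1, e2, e3} \<subseteq> left_invariant_fields A mul \<and>
     (\<forall>X\<in>left_invariant_fields A mul. \<exists>!(a, b, c).
        X = (\<lambda>p f. a * e1 p f + b * e2 p f + c * e3 p f)) \<and>
     (\<forall>p. g p (e1 p) (e1 p) = 1 \<and> g p (e2 p) (e2 p) = 1 \<and> g p (e3 p) (e3 p) = - 1 \<and>
          g p (e1 p) (e2 p) = 0 \<and> g p (e1 p) (e3 p) = 0 \<and> g p (e2 p) (e3 p) = 0)"


section \<open>Connection and curvature\<close>

type_synonym 'a connection = "'a vfield \<Rightarrow> 'a vfield \<Rightarrow> 'a vfield"

definition affine_connection :: "('a, 'n::finite) chart set \<Rightarrow> 'a connection \<Rightarrow> bool" where
  "affine_connection A D \<longleftrightarrow>
     (\<forall>X\<in>vector_fields A. \<forall>Y\<in>vector_fields A. D X Y \<in> vector_fields A) \<and>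
     (\<forall>X\<in>vector_fields A. \<forall>Y\<in>vector_fields A. \<forall>Z\<in>vector_fields A.
        D (\<lambda>p f. X p f + Y p f) Z = (\<lambda>p f. D X Z p f + D Y Z p f) \<and>
        D X (\<lambda>p f. Y p f + Z p f) = (\<lambda>p f. D X Y p f + D X Z p f)) \<and>
     (\<forall>h\<in>smooth_functions A. \<forall>X\<in>vector_fields A. \<forall>Y\<in>vector_fields A.
        D (\<lambda>p f. h p * X p f) Y = (\<lambda>p f. h p * D X Y p f) \<and>
        D X (\<lambda>p f. h p * Y p f) = (\<lambda>p f. X p h * Y p f + h p * D X Y p f))"

definition levi_civita_connection :: "('a, 'n::finite) chart set \<Rightarrow> 'a metric \<Rightarrow> 'a connection \<Rightarrow> bool" where
  "levi_civita_connection A g D \<longleftrightarrow>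
     affine_connection A D \<and>
     (\<forall>X\<in>vector_fields A. \<forall>Y\<in>vector_fields A.
        (\<lambda>p f. D X Y p f - D Y X p f) = bracket X Y) \<and>
     (\<forall>X\<in>vector_fields A. \<forall>Y\<in>vector_fields A. \<forall>Z\<in>vector_fields A. \<forall>p.
        X p (metric_on_fields g Y Z)
          = metric_on_fields g (D X Y) Z p + metric_on_fields g Y (D X Z) p)"

definition curvature :: "'a connection \<Rightarrow> 'a vfield \<Rightarrow> 'a vfield \<Rightarrow> 'a vfield \<Rightarrow> 'a vfield" where
  "curvature D X Y Z =
     (\<lambda>p f. D X (D Y Z) p f - D Y (D X Z) p f - D (bracket X Y) Z p f)"

definition curvature4 ::
  "'a metric \<Rightarrow> 'a connection \<Rightarrow> 'a vfield \<Rightarrow> 'a vfield \<Rightarrow> 'a vfield \<Rightarrow> 'a vfield \<Rightarrow> 'a \<Rightarrow> real" where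
  "curvature4 g D X Y Z W = (\<lambda>p. - metric_on_fields g (curvature D X Y Z) W p)"

definition kulkarni_nomizu ::
  "('a vfield \<Rightarrow> 'a vfield \<Rightarrow> 'a \<Rightarrow> real) \<Rightarrow> ('a vfield \<Rightarrow> 'a vfield \<Rightarrow> 'a \<Rightarrow> real)
     \<Rightarrow> 'a vfield \<Rightarrow> 'a vfield \<Rightarrow> 'a vfield \<Rightarrow> 'a vfield \<Rightarrow> 'a \<Rightarrow> real" where
  "kulkarni_nomizu T1 T2 X Y Z W = (\<lambda>p. T1 X W p * T2 Y Z p + T1 Y Z p * T2 X W p
     - T1 X Z p * T2 Y W p - T1 Y W p * T2 X Z p)"


section \<open>Riemann solitons\<close>

definition left_invariant_riemann_soliton ::
  "('a, 'n::finite) chart set \<Rightarrow> ('a \<Rightarrow> 'a \<Rightarrow> 'a) \<Rightarrow> 'a metric \<Rightarrow> 'a connection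
     \<Rightarrow> 'a vfield \<Rightarrow> real \<Rightarrow> bool" where
  "left_invariant_riemann_soliton A mul g D V c \<longleftrightarrow>
     V \<in> left_invariant_fields A mul \<and>
     (\<forall>X\<in>vector_fields A. \<forall>Y\<in>vector_fields A. \<forall>Z\<in>vector_fields A. \<forall>W\<in>vector_fields A. \<forall>p.
        curvature4 g D X Y Z W p
          + 1/2 * kulkarni_nomizu (lie_derivative_metric g V) (metric_on_fields g) X Y Z W p
        = c/2 * kulkarni_nomizu (metric_on_fields g) (metric_on_fields g) X Y Z W p)"

end

theory Submission
  imports Defs
begin

text \<open>A frame identifies every field with three smooth coefficient functions, since the tangent
  spaces are three-dimensional. The curvature and \<open>L_V g\<close> are tensorial, so the soliton equation
  holds for all fields iff it holds for constant-coefficient combinations of the frame. On these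
  the Koszul formula gives the connection from the structure constants, and the equation becomes
  polynomial in the coefficients. Three of its diagonal components form a linear system in
  \<open>\<alpha> l2\<close>, \<open>\<alpha> l3\<close>, \<open>l\<close>, and an off-diagonal one determines \<open>\<alpha> l1\<close>.\<close>

section \<open>Smooth functions and tangent vectors\<close>

text \<open>\<open>frechet_derivative\<close> is a choice from the relation
  \<open>has_derivative\<close>. That relation is local, so the two choices coincide even where no
  derivative exists.\<close>

lemma frechet_derivative_cong_open:
  assumes "open S" "x \<in> S" "\<And>y. y \<in> S \<Longrightarrow> f y = g y"
  shows "frechet_derivative f (at x) = frechet_derivative g (at x)"
proof -
  have "(f has_derivative d) (at x) \<longleftrightarrow> (g has_derivative d) (at x)" for d
    using assms has_derivative_transform_within_open[of _ _ x UNIV S] by metis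
  then show ?thesis
    by (simp add: frechet_derivative_def)
qed

lemma differentiable_cong_open:
  assumes "open S" "x \<in> S" "\<And>y. y \<in> S \<Longrightarrow> f y = g y" "f differentiable (at x)"
  shows "g differentiable (at x)"
  using assms has_derivative_transform_within_open[of _ _ x UNIV S]
  unfolding differentiable_def by metis

lemma frechet_derivative_plus:
  assumes "f differentiable (at x)" "g differentiable (at x)"
  shows "frechet_derivative (\<lambda>x. f x + g x) (at x)
    = (\<lambda>v. frechet_derivative f (at x) v + frechet_derivative g (at x) v)"
  using assms
  by (intro frechet_derivative_at[symmetric] has_derivative_add iffD1[OF frechet_derivative_works])

lemma frechet_derivative_times:
  fixes f g :: "'a::real_normed_vector \<Rightarrow> real"
  assumes "f differentiable (at x)" "g differentiable (at x)"
  shows "frechet_derivative (\<lambda>x. f x * g x) (at x)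
    = (\<lambda>v. f x * frechet_derivative g (at x) v + frechet_derivative f (at x) v * g x)"
  using assms
  by (intro frechet_derivative_at[symmetric] has_derivative_mult iffD1[OF frechet_derivative_works])

lemma Ck_on_SucD:
  assumes "Ck_on (Suc k) S f"
  shows "x \<in> S \<Longrightarrow> f differentiable (at x)" "Ck_on k S (\<lambda>x. frechet_derivative f (at x) v)"
  using assms by simp_all

lemma Ck_on_SucI:
  assumes "\<And>x. x \<in> S \<Longrightarrow> f differentiable (at x)"
    and "\<And>v. Ck_on k S (\<lambda>x. frechet_derivative f (at x) v)"
  shows "Ck_on (Suc k) S f"
  using assms by simp

text \<open>On an open set the unrestricted derivatives depend only on the values there, so equality
  on \<open>S\<close> passes to derivatives of every order.\<close>

lemma Ck_on_cong:
  assumes "open S" "\<And>x. x \<in> S \<Longrightarrow> f x = g x" "Ck_on k S f"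
  shows "Ck_on k S g"
  using assms(2,3)
proof (induction k arbitrary: f g)
  case 0
  then have "continuous_on S g"
    using continuous_on_cong[OF refl, of S f g] by simp
  then show ?case by simp
next
  case (Suc k)
  note f = Ck_on_SucD[OF Suc.prems(2)]
  show ?case
  proof (rule Ck_on_SucI)
    show "g differentiable (at x)" if "x \<in> S" for x
      using assms(1) that Suc.prems(1) f(1)[OF that] by (rule differentiable_cong_open)
    show "Ck_on k S (\<lambda>x. frechet_derivative g (at x) v)" for v
      by (rule Suc.IH[OF _ f(2)[of v]])
        (rule fun_cong[OF frechet_derivative_cong_open[OF assms(1) _ Suc.prems(1)]])
  qed
qed

text \<open>At the bottom, differentiability gives continuity; above it the induction runs through
  the directional derivatives. The product rule uses this to lower the order of the undifferentiated
  factor.\<close>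

lemma Ck_on_Suc_imp: "Ck_on (Suc k) S f \<Longrightarrow> Ck_on k S f"
proof (induction k arbitrary: f)
  case 0
  then show ?case
    by (simp add: continuous_at_imp_continuous_on differentiable_imp_continuous_within)
next
  case (Suc k)
  show ?case
    by (intro Ck_on_SucI Ck_on_SucD(1)[OF Suc.prems] Suc.IH[OF Ck_on_SucD(2)[OF Suc.prems]])
qed

lemma Ck_on_const: "Ck_on k S (\<lambda>x. c)"
  by (induction k arbitrary: c) simp_all

lemma Ck_on_add:
  assumes "open S" "Ck_on k S f" "Ck_on k S g"
  shows "Ck_on k S (\<lambda>x. f x + g x)"
  using assms(2,3)
proof (induction k arbitrary: f g)
  case 0
  then show ?case by (simp add: continuous_on_add)
next
  case (Suc k)
  note f = Ck_on_SucD[OF Suc.prems(1)] and g = Ck_on_SucD[OF Suc.prems(2)]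
  show ?case
  proof (rule Ck_on_SucI)
    show "(\<lambda>x. f x + g x) differentiable (at x)" if "x \<in> S" for x
      using f(1)[OF that] g(1)[OF that] by (rule differentiable_add)
    show "Ck_on k S (\<lambda>x. frechet_derivative (\<lambda>x. f x + g x) (at x) v)" for v
      using frechet_derivative_plus[OF f(1) g(1)]
      by (intro Ck_on_cong[OF assms(1) _ Suc.IH[OF f(2)[of v] g(2)[of v]]]) simp
  qed
qed

lemma Ck_on_mult:
  fixes f g :: "'a::real_normed_vector \<Rightarrow> real"
  assumes "open S" "Ck_on k S f" "Ck_on k S g"
  shows "Ck_on k S (\<lambda>x. f x * g x)"
  using assms(2,3)
proof (induction k arbitrary: f g)
  case 0
  then show ?case by (simp add: continuous_on_mult)
next
  case (Suc k)
  note f = Ck_on_SucD[OF Suc.prems(1)] and g = Ck_on_SucD[OF Suc.prems(2)]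
  show ?case
  proof (rule Ck_on_SucI)
    show "(\<lambda>x. f x * g x) differentiable (at x)" if "x \<in> S" for x
      using f(1)[OF that] g(1)[OF that] by (rule differentiable_mult)
    \<comment> \<open>By the Leibniz rule each summand pairs a derivative of order \<open>k\<close>
      with an undifferentiated factor lowered from \<open>Suc k\<close> to \<open>k\<close>.\<close>
    show "Ck_on k S (\<lambda>x. frechet_derivative (\<lambda>x. f x * g x) (at x) v)" for v
      using frechet_derivative_times[OF f(1) g(1)]
      by (intro Ck_on_cong[OF assms(1) _ Ck_on_add[OF assms(1)
            Suc.IH[OF Ck_on_Suc_imp[OF Suc.prems(1)] g(2)[of v]]
            Suc.IH[OF f(2)[of v] Ck_on_Suc_imp[OF Suc.prems(2)]]]]) simp
  qed
qed

section \<open>Charts and the algebra of smooth functions\<close>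

lemma smooth_on_imp_differentiable: "smooth_on S f \<Longrightarrow> x \<in> S \<Longrightarrow> f differentiable (at x)"
  unfolding smooth_on_def by (drule spec[of _ "Suc 0"]) simp

lemma smooth_atlas_chart:
  assumes "smooth_atlas A" "(U, \<phi>) \<in> A"
  shows "open U" "open (\<phi> ` U)" "homeomorphism U (\<phi> ` U) \<phi> (inv_into U \<phi>)"
proof -
  have "\<forall>(U, \<phi>)\<in>A. open U \<and> open (\<phi> ` U) \<and> homeomorphism U (\<phi> ` U) \<phi> (inv_into U \<phi>)"
    using assms(1) unfolding smooth_atlas_def by (elim conjE)
  from bspec[OF this assms(2)]
  show "open U" "open (\<phi> ` U)" "homeomorphism U (\<phi> ` U) \<phi> (inv_into U \<phi>)"
    by simp_all
qed

lemma inv_into_chart: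
  assumes "smooth_atlas A" "(U, \<phi>) \<in> A" "p \<in> U"
  shows "inv_into U \<phi> (\<phi> p) = p"
  using homeomorphism_apply1[OF smooth_atlas_chart(3)[OF assms(1,2)] assms(3)] .

lemma smooth_functions_const: "(\<lambda>x. c) \<in> smooth_functions A"
  by (auto simp: smooth_functions_def smooth_on_def o_def Ck_on_const)

lemma smooth_functions_add:
  assumes "smooth_atlas A" "f \<in> smooth_functions A" "h \<in> smooth_functions A"
  shows "(\<lambda>x. f x + h x) \<in> smooth_functions A"
proof -
  have "smooth_on (\<phi> ` U) (\<lambda>x. f (inv_into U \<phi> x) + h (inv_into U \<phi> x))"
    if U: "(U, \<phi>) \<in> A" for U \<phi>
    using assms(2,3) U
    by (auto simp: smooth_functions_def smooth_on_def o_def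
        intro!: Ck_on_add[OF smooth_atlas_chart(2)[OF assms(1) U]])
  then show ?thesis
    by (auto simp: smooth_functions_def o_def)
qed

lemma smooth_functions_mult:
  assumes "smooth_atlas A" "f \<in> smooth_functions A" "h \<in> smooth_functions A"
  shows "(\<lambda>x. f x * h x) \<in> smooth_functions A"
proof -
  have "smooth_on (\<phi> ` U) (\<lambda>x. f (inv_into U \<phi> x) * h (inv_into U \<phi> x))"
    if U: "(U, \<phi>) \<in> A" for U \<phi>
    using assms(2,3) U
    by (auto simp: smooth_functions_def smooth_on_def o_def
        intro!: Ck_on_mult[OF smooth_atlas_chart(2)[OF assms(1) U]])
  then show ?thesis
    by (auto simp: smooth_functions_def o_def)
qed

section \<open>Tangent spaces in coordinates\<close>

text \<open>With chart and point fixed, the operator depends on the direction \<open>v\<close>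
  alone, and linearly. A tangent space is then the range of one linear map.\<close>

definition chart_tangent ::
  "('a, 'n::finite) chart set \<Rightarrow> 'a set \<Rightarrow> ('a \<Rightarrow> real ^ 'n) \<Rightarrow> 'a \<Rightarrow> real ^ 'n \<Rightarrow> 'a tangent" where
  "chart_tangent A U \<phi> p v = (\<lambda>f. if f \<in> smooth_functions A
     then frechet_derivative (f \<circ> inv_into U \<phi>) (at (\<phi> p)) v else 0)"

lemma smooth_function_differentiable:
  assumes "(U, \<phi>) \<in> A" "p \<in> U" "f \<in> smooth_functions A"
  shows "(f \<circ> inv_into U \<phi>) differentiable (at (\<phi> p))"
  using assms by (auto simp: smooth_functions_def intro!: smooth_on_imp_differentiable)

lemma chart_tangent_linear:
  assumes "(U, \<phi>) \<in> A" "p \<in> U"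
  shows "chart_tangent A U \<phi> p (a *\<^sub>R v + b *\<^sub>R w)
    = (\<lambda>f. a * chart_tangent A U \<phi> p v f + b * chart_tangent A U \<phi> p w f)"
proof
  fix f
  show "chart_tangent A U \<phi> p (a *\<^sub>R v + b *\<^sub>R w) f
    = a * chart_tangent A U \<phi> p v f + b * chart_tangent A U \<phi> p w f"
  proof (cases "f \<in> smooth_functions A")
    case True
    interpret linear "frechet_derivative (f \<circ> inv_into U \<phi>) (at (\<phi> p))"
      using smooth_function_differentiable[OF assms True] linear_frechet_derivative by blast
    show ?thesis using True by (simp add: chart_tangent_def add scaleR)
  qed (simp add: chart_tangent_def)
qed

text \<open>Chain rule: near \<open>\<phi> p\<close> the expression of \<open>f\<close> in the first
  chart is its expression in the second composed with the transition map, whose derivative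
  transforms the direction.\<close>

lemma chart_tangent_change:
  assumes "smooth_atlas A" "(U, \<phi>) \<in> A" "p \<in> U" "(W, \<psi>) \<in> A" "p \<in> W"
  shows "chart_tangent A U \<phi> p v
    = chart_tangent A W \<psi> p (frechet_derivative (\<psi> \<circ> inv_into U \<phi>) (at (\<phi> p)) v)"
proof
  fix f
  show "chart_tangent A U \<phi> p v f
    = chart_tangent A W \<psi> p (frechet_derivative (\<psi> \<circ> inv_into U \<phi>) (at (\<phi> p)) v) f"
  proof (cases "f \<in> smooth_functions A")
    case True
    let ?\<tau> = "\<psi> \<circ> inv_into U \<phi>"
    let ?S = "\<phi> ` (U \<inter> W)"
    note inv = inv_into_chart[OF assms(1,2)] inv_into_chart[OF assms(1,4)]
    \<comment> \<open>The overlap is open in \<open>U\<close>, and the homeomorphism carries it to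
      an open part of the open chart image.\<close>
    have S: "open ?S"
    proof -
      have "openin (top_of_set (\<phi> ` U)) ?S"
        using smooth_atlas_chart[OF assms(1,2)] smooth_atlas_chart(1)[OF assms(1,4)]
        by (intro homeomorphism_imp_open_map[of U "\<phi> ` U" \<phi> "inv_into U \<phi>"]) (auto simp: openin_open)
      then show ?thesis
        using smooth_atlas_chart(2)[OF assms(1,2)] openin_open_trans by blast
    qed
    have pS: "\<phi> p \<in> ?S" using assms by auto
    have "smooth_on ?S ?\<tau>"
      using assms(1,2,4) unfolding smooth_atlas_def by fast
    then have \<tau>: "(?\<tau> has_derivative frechet_derivative ?\<tau> (at (\<phi> p))) (at (\<phi> p))"
      using smooth_on_imp_differentiable[OF _ pS] frechet_derivative_works by blast
    have "((f \<circ> inv_into W \<psi>) has_derivative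
        frechet_derivative (f \<circ> inv_into W \<psi>) (at (\<psi> p))) (at (?\<tau> (\<phi> p)))"
      using smooth_function_differentiable[OF assms(4,5) True] inv(1)[OF assms(3)]
      by (simp add: frechet_derivative_works)
    from diff_chain_at[OF \<tau> this]
    have "((f \<circ> inv_into W \<psi>) \<circ> ?\<tau> has_derivative
        frechet_derivative (f \<circ> inv_into W \<psi>) (at (\<psi> p)) \<circ> frechet_derivative ?\<tau> (at (\<phi> p))) (at (\<phi> p))" .
    then have "((f \<circ> inv_into U \<phi>) has_derivative
        frechet_derivative (f \<circ> inv_into W \<psi>) (at (\<psi> p)) \<circ> frechet_derivative ?\<tau> (at (\<phi> p))) (at (\<phi> p))"
      by (rule has_derivative_transform_within_open[OF _ S pS]) (auto simp: inv)
    from frechet_derivative_at[OF this, symmetric] show ?thesis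
      using True by (simp add: chart_tangent_def)
  qed (simp add: chart_tangent_def)
qed

text \<open>Every direction in another chart transforms into one of the fixed chart, so a single
  chart already yields all tangent vectors.\<close>

lemma tangent_space_eq_range:
  assumes "smooth_atlas A" "(U, \<phi>) \<in> A" "p \<in> U"
  shows "tangent_space A p = range (chart_tangent A U \<phi> p)"
proof -
  have "tangent_space A p = {chart_tangent A W \<psi> p v | W \<psi> v. (W, \<psi>) \<in> A \<and> p \<in> W}"
    by (simp add: tangent_space_def chart_tangent_def)
  moreover have "chart_tangent A W \<psi> p v \<in> range (chart_tangent A U \<phi> p)"
    if "(W, \<psi>) \<in> A" "p \<in> W" for W \<psi> v
    using chart_tangent_change[OF assms(1) that assms(2,3)] by blast
  moreover have "range (chart_tangent A U \<phi> p) \<subseteq> {chart_tangent A W \<psi> p v | W \<psi> v. (W, \<psi>) \<in> A \<and> p \<in> W}"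
    using assms(2,3) by blast
  ultimately show ?thesis
    by auto
qed

lemma chart_exists:
  assumes "smooth_atlas A"
  obtains U \<phi> where "(U, \<phi>) \<in> A" "p \<in> U"
  using assms unfolding smooth_atlas_def by fast

lemma tangent_space_lincomb:
  assumes "smooth_atlas A" "u \<in> tangent_space A p" "v \<in> tangent_space A p"
  shows "(\<lambda>f. a * u f + b * v f) \<in> tangent_space A p"
proof -
  obtain U \<phi> where U: "(U, \<phi>) \<in> A" "p \<in> U" using chart_exists[OF assms(1)] .
  show ?thesis
    using assms(2,3) chart_tangent_linear[OF U, of a _ b, symmetric]
    unfolding tangent_space_eq_range[OF assms(1) U] by auto
qed

lemma tangent_const: "u \<in> tangent_space A p \<Longrightarrow> u (\<lambda>x. c) = 0"
  by (auto simp: tangent_space_def o_def)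

section \<open>Vector fields as a module over the smooth functions\<close>

lemma vector_fields_tangent: "X \<in> vector_fields A \<Longrightarrow> X p \<in> tangent_space A p"
  by (simp add: vector_fields_def)

lemma vector_fields_smooth:
  "X \<in> vector_fields A \<Longrightarrow> f \<in> smooth_functions A \<Longrightarrow> (\<lambda>p. X p f) \<in> smooth_functions A"
  by (simp add: vector_fields_def)

lemma vector_fields_add:
  assumes "smooth_atlas A" "X \<in> vector_fields A" "Y \<in> vector_fields A"
  shows "(\<lambda>p f. X p f + Y p f) \<in> vector_fields A"
  unfolding vector_fields_def
proof (intro CollectI conjI allI ballI)
  show "(\<lambda>f. X p f + Y p f) \<in> tangent_space A p" for p
    using tangent_space_lincomb[OF assms(1) vector_fields_tangent[OF assms(2)]
        vector_fields_tangent[OF assms(3)], where a = 1 and b = 1] by simp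
  show "(\<lambda>p. X p f + Y p f) \<in> smooth_functions A" if "f \<in> smooth_functions A" for f
    by (rule smooth_functions_add[OF assms(1) vector_fields_smooth[OF assms(2) that] vector_fields_smooth[OF assms(3) that]])
qed

lemma vector_fields_smult:
  assumes "smooth_atlas A" "h \<in> smooth_functions A" "X \<in> vector_fields A"
  shows "(\<lambda>p f. h p * X p f) \<in> vector_fields A"
  unfolding vector_fields_def
proof (intro CollectI conjI allI ballI)
  show "(\<lambda>f. h p * X p f) \<in> tangent_space A p" for p
    using tangent_space_lincomb[OF assms(1) vector_fields_tangent[OF assms(3)]
        vector_fields_tangent[OF assms(3)], where a = "h p" and b = 0] by simp
  show "(\<lambda>p. h p * X p f) \<in> smooth_functions A" if "f \<in> smooth_functions A" for f
    by (rule smooth_functions_mult[OF assms(1,2) vector_fields_smooth[OF assms(3) that]])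
qed

section \<open>Orthonormal frames and tensoriality\<close>

text \<open>A global orthonormal frame on a three-dimensional manifold carries all tensorial
  arguments; the group multiplication enters only with the soliton equation.\<close>

locale lorentz_frame =
  fixes A :: "('a::{t2_space,second_countable_topology}, 3) chart set"
    and g :: "'a metric" and D :: "'a connection" and e1 e2 e3 :: "'a vfield"
  assumes atlas: "smooth_atlas A"
    and metric: "lorentzian_metric A g"
    and connection: "levi_civita_connection A g D"
    and frame_fields: "e1 \<in> vector_fields A" "e2 \<in> vector_fields A" "e3 \<in> vector_fields A"
    and frame_orthonormal:
      "g p (e1 p) (e1 p) = 1" "g p (e2 p) (e2 p) = 1" "g p (e3 p) (e3 p) = - 1"
      "g p (e1 p) (e2 p) = 0" "g p (e1 p) (e3 p) = 0" "g p (e2 p) (e3 p) = 0"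
begin

lemma metric_sym:
  "u \<in> tangent_space A p \<Longrightarrow> v \<in> tangent_space A p \<Longrightarrow> g p u v = g p v u"
  using metric unfolding lorentzian_metric_def by blast

lemma metric_lincomb_left:
  assumes "u \<in> tangent_space A p" "v \<in> tangent_space A p" "w \<in> tangent_space A p"
  shows "g p (\<lambda>f. a * u f + b * v f) w = a * g p u w + b * g p v w"
  using metric assms unfolding lorentzian_metric_def by blast

lemma metric_lincomb_right:
  assumes "u \<in> tangent_space A p" "v \<in> tangent_space A p" "w \<in> tangent_space A p"
  shows "g p w (\<lambda>f. a * u f + b * v f) = a * g p w u + b * g p w v"
  using metric_lincomb_left[OF assms] assms(3) tangent_space_lincomb[OF atlas assms(1,2)]
    metric_sym assms by metis

lemma metric_smooth:
  "X \<in> vector_fields A \<Longrightarrow> Y \<in> vector_fields A \<Longrightarrow> (\<lambda>p. g p (X p) (Y p)) \<in> smooth_functions A"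
  using metric unfolding lorentzian_metric_def by blast

text \<open>These fields serve both as the left-invariant candidates for \<open>V\<close> and as
  test fields that realise any tangent vector at a given point.\<close>

definition comb :: "real \<Rightarrow> real \<Rightarrow> real \<Rightarrow> 'a vfield" where
  "comb a b c = (\<lambda>p f. a * e1 p f + b * e2 p f + c * e3 p f)"

lemma comb_field: "comb a b c \<in> vector_fields A"
  unfolding comb_def
  by (intro vector_fields_add vector_fields_smult[where h = "\<lambda>p. c" for c]
      smooth_functions_const atlas frame_fields)

lemma comb_frame: "comb 1 0 0 = e1" "comb 0 1 0 = e2" "comb 0 0 1 = e3"
  by (simp_all add: comb_def)

lemma metric_comb_left:
  assumes "w \<in> tangent_space A p"
  shows "g p (comb a b c p) w = a * g p (e1 p) w + b * g p (e2 p) w + c * g p (e3 p) w"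
proof -
  note e = frame_fields[THEN vector_fields_tangent, of p]
  have ab: "(\<lambda>f. a * e1 p f + b * e2 p f) \<in> tangent_space A p"
    using tangent_space_lincomb[OF atlas e(1,2)] .
  have "comb a b c p = (\<lambda>f. 1 * (a * e1 p f + b * e2 p f) + c * e3 p f)"
    by (simp add: comb_def)
  then show ?thesis
    using metric_lincomb_left[OF ab e(3) assms, of 1 c] metric_lincomb_left[OF e(1,2) assms]
    by simp
qed

lemma metric_frame_swap: "g p (e2 p) (e1 p) = 0" "g p (e3 p) (e1 p) = 0" "g p (e3 p) (e2 p) = 0"
  using frame_orthonormal frame_fields[THEN vector_fields_tangent] metric_sym by metis+

lemma metric_comb_frame:
  "g p (comb a b c p) (e1 p) = a" "g p (comb a b c p) (e2 p) = b" "g p (comb a b c p) (e3 p) = - c"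
  using frame_fields[THEN vector_fields_tangent, of p]
  by (simp_all add: metric_comb_left frame_orthonormal metric_frame_swap)

lemma metric_comb_comb: "g p (comb a b c p) (comb x y z p) = a * x + b * y - c * z"
  using frame_fields[THEN vector_fields_tangent, of p] vector_fields_tangent[OF comb_field, where p = p]
  by (simp add: metric_comb_left[of "comb x y z p"] metric_sym[of _ p "comb x y z p"] metric_comb_frame)

text \<open>Pairing with the frame recovers the coefficients of a combination, so the frame vectors
  are independent; three independent vectors span a three-dimensional tangent space. The minus sign
  compensates for the timelike \<open>e3\<close>.\<close>

lemma tangent_expansion:
  assumes "u \<in> tangent_space A p"
  shows "u = comb (g p u (e1 p)) (g p u (e2 p)) (- g p u (e3 p)) p"
proof -
  obtain U \<phi> where U: "(U, \<phi>) \<in> A" "p \<in> U" using chart_exists[OF atlas] .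
  let ?T = "chart_tangent A U \<phi> p"
  note range = tangent_space_eq_range[OF atlas U]
  obtain v1 v2 v3 where v: "e1 p = ?T v1" "e2 p = ?T v2" "e3 p = ?T v3"
    using frame_fields[THEN vector_fields_tangent, of p] unfolding range by blast
  \<comment> \<open>\<open>S\<close> sends frame coefficients to directions in the chart, turning
    the spanning question into one about a linear endomorphism of \<open>real^3\<close>.\<close>
  define S where "S x = (x$1) *\<^sub>R v1 + (x$2) *\<^sub>R v2 + (x$3) *\<^sub>R v3" for x :: "real^3"
  have T: "?T (S x) = comb (x$1) (x$2) (x$3) p" for x
    using chart_tangent_linear[OF U, of "x$1" v1 "x$2" v2]
      chart_tangent_linear[OF U, of 1 "(x$1) *\<^sub>R v1 + (x$2) *\<^sub>R v2" "x$3" v3]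
    by (simp add: S_def comb_def v)
  have S: "linear S"
    by (rule linearI) (simp_all add: S_def algebra_simps scaleR_add_left)
  have "x = 0" if "S x = 0" for x
  proof -
    have "comb (x$1) (x$2) (x$3) p = comb 0 0 0 p"
      using T[of x] T[of 0] that by (simp add: linear_0[OF S])
    then have "x$1 = 0" "x$2 = 0" "x$3 = 0"
      using metric_comb_frame[of p] by (metis neg_equal_iff_equal)+
    then show ?thesis by (simp add: vec_eq_iff forall_3)
  qed
  then have "surj S"
    using S linear_injective_0 linear_injective_imp_surjective by blast
  then obtain x where "u = ?T (S x)"
    using assms unfolding range by (metis rangeE surjD)
  then show ?thesis
    unfolding T by (simp add: metric_comb_frame)
qed

lemma field_expansion:
  assumes "X \<in> vector_fields A"
  shows "X p = comb (g p (X p) (e1 p)) (g p (X p) (e2 p)) (- g p (X p) (e3 p)) p"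
  using tangent_expansion vector_fields_tangent[OF assms] by blast

section \<open>Tensoriality and pointwise dependence\<close>

definition tensorial_at :: "'a \<Rightarrow> ('a vfield \<Rightarrow> real) \<Rightarrow> bool" where
  "tensorial_at p F \<longleftrightarrow>
     (\<forall>X\<in>vector_fields A. \<forall>Y\<in>vector_fields A. F (\<lambda>p f. X p f + Y p f) = F X + F Y) \<and>
     (\<forall>h\<in>smooth_functions A. \<forall>X\<in>vector_fields A. F (\<lambda>p f. h p * X p f) = h p * F X)"

text \<open>The frame is global, so \<open>X\<close> expands everywhere with smooth coefficients
  \<open>g(X, e_i)\<close>; linearity over functions then takes their values at \<open>p\<close> out
  of \<open>F\<close>.\<close>

lemma tensorial_at_frame:
  assumes "tensorial_at p F" "X \<in> vector_fields A"
  shows "F X = g p (X p) (e1 p) * F e1 + g p (X p) (e2 p) * F e2 - g p (X p) (e3 p) * F e3"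
proof -
  let ?h = "\<lambda>e q. g q (X q) (e q)"
  \<comment> \<open>The sign is a constant factor here, which makes the coefficient a product of two
    smooth functions.\<close>
  let ?h3 = "\<lambda>q. - 1 * ?h e3 q"
  have h: "?h e1 \<in> smooth_functions A" "?h e2 \<in> smooth_functions A" "?h3 \<in> smooth_functions A"
    using metric_smooth[OF assms(2)] frame_fields
      smooth_functions_mult[OF atlas smooth_functions_const metric_smooth[OF assms(2) frame_fields(3)]]
    by blast+
  note f = vector_fields_smult[OF atlas h(1) frame_fields(1)]
    vector_fields_smult[OF atlas h(2) frame_fields(2)]
    vector_fields_smult[OF atlas h(3) frame_fields(3)]
  have add: "F (\<lambda>p f. Y p f + Z p f) = F Y + F Z"
    if "Y \<in> vector_fields A" "Z \<in> vector_fields A" for Y Z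
    using assms(1) that unfolding tensorial_at_def by blast
  have smult: "F (\<lambda>p f. k p * Y p f) = k p * F Y"
    if "k \<in> smooth_functions A" "Y \<in> vector_fields A" for k Y
    using assms(1) that unfolding tensorial_at_def by blast
  have "X = (\<lambda>q f. (?h e1 q * e1 q f + ?h e2 q * e2 q f) + ?h3 q * e3 q f)"
  proof
    show "X q = (\<lambda>f. (?h e1 q * e1 q f + ?h e2 q * e2 q f) + ?h3 q * e3 q f)" for q
      using field_expansion[OF assms(2), of q] by (simp add: comb_def)
  qed
  then have "F X = F (\<lambda>q f. (?h e1 q * e1 q f + ?h e2 q * e2 q f) + ?h3 q * e3 q f)"
    by (rule arg_cong)
  also have "\<dots> = ?h e1 p * F e1 + ?h e2 p * F e2 + ?h3 p * F e3"
    by (simp only: add[OF vector_fields_add[OF atlas f(1,2)] f(3)] add[OF f(1,2)]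
        smult[OF h(1) frame_fields(1)] smult[OF h(2) frame_fields(2)] smult[OF h(3) frame_fields(3)])
  finally show ?thesis by simp
qed

lemma tensorial_at_cong:
  assumes "tensorial_at p F" "X \<in> vector_fields A" "Y \<in> vector_fields A" "X p = Y p"
  shows "F X = F Y"
  using tensorial_at_frame[OF assms(1,2)] tensorial_at_frame[OF assms(1,3)] assms(4) by simp

section \<open>The connection and the tensoriality of its curvature\<close>

lemma connection_field: "X \<in> vector_fields A \<Longrightarrow> Y \<in> vector_fields A \<Longrightarrow> D X Y \<in> vector_fields A"
  using connection unfolding levi_civita_connection_def affine_connection_def by blast

lemma connection_add:
  assumes "X \<in> vector_fields A" "Y \<in> vector_fields A" "Z \<in> vector_fields A"
  shows "D (\<lambda>p f. X p f + Y p f) Z = (\<lambda>p f. D X Z p f + D Y Z p f)"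
    and "D X (\<lambda>p f. Y p f + Z p f) = (\<lambda>p f. D X Y p f + D X Z p f)"
  using connection assms unfolding levi_civita_connection_def affine_connection_def by blast+

lemma connection_smult:
  assumes "h \<in> smooth_functions A" "X \<in> vector_fields A" "Y \<in> vector_fields A"
  shows "D (\<lambda>p f. h p * X p f) Y = (\<lambda>p f. h p * D X Y p f)"
    and "D X (\<lambda>p f. h p * Y p f) = (\<lambda>p f. X p h * Y p f + h p * D X Y p f)"
  using connection assms unfolding levi_civita_connection_def affine_connection_def by blast+

lemma torsion_free:
  "X \<in> vector_fields A \<Longrightarrow> Y \<in> vector_fields A \<Longrightarrow> bracket X Y = (\<lambda>p f. D X Y p f - D Y X p f)"
  using connection unfolding levi_civita_connection_def by auto

lemma metric_compatible:
  assumes "X \<in> vector_fields A" "Y \<in> vector_fields A" "Z \<in> vector_fields A"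
  shows "X p (metric_on_fields g Y Z)
    = metric_on_fields g (D X Y) Z p + metric_on_fields g Y (D X Z) p"
  using connection assms unfolding levi_civita_connection_def by blast

lemma vector_fields_diff:
  assumes "X \<in> vector_fields A" "Y \<in> vector_fields A"
  shows "(\<lambda>p f. X p f - Y p f) \<in> vector_fields A"
  using vector_fields_add[OF atlas assms(1) vector_fields_smult[OF atlas smooth_functions_const assms(2)],
      of "- 1"] by simp

text \<open>Torsion-freeness exhibits the bracket as a difference of covariant derivatives, which
  are fields by the connection axioms.\<close>

lemma bracket_field: "X \<in> vector_fields A \<Longrightarrow> Y \<in> vector_fields A \<Longrightarrow> bracket X Y \<in> vector_fields A"
  using torsion_free vector_fields_diff connection_field by simp

lemma connection_diff:
  assumes "X \<in> vector_fields A" "Y \<in> vector_fields A" "Z \<in> vector_fields A"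
  shows "D (\<lambda>p f. X p f - Y p f) Z = (\<lambda>p f. D X Z p f - D Y Z p f)"
  using connection_add(1)[OF assms(1) vector_fields_smult[OF atlas smooth_functions_const assms(2)] assms(3),
      of "- 1"] connection_smult(1)[OF smooth_functions_const assms(2,3), of "- 1"]
  by simp

lemma metric_add_left:
  assumes "X \<in> vector_fields A" "Y \<in> vector_fields A" "w \<in> tangent_space A p"
  shows "g p (\<lambda>f. X p f + Y p f) w = g p (X p) w + g p (Y p) w"
  using metric_lincomb_left[OF vector_fields_tangent[OF assms(1)] vector_fields_tangent[OF assms(2)] assms(3),
      of 1 1] by simp

lemma metric_diff_left:
  assumes "X \<in> vector_fields A" "Y \<in> vector_fields A" "w \<in> tangent_space A p"
  shows "g p (\<lambda>f. X p f - Y p f) w = g p (X p) w - g p (Y p) w"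
  using metric_lincomb_left[OF vector_fields_tangent[OF assms(1)] vector_fields_tangent[OF assms(2)] assms(3),
      of 1 "- 1"] by simp

lemma metric_smult_left:
  assumes "u \<in> tangent_space A p" "w \<in> tangent_space A p"
  shows "g p (\<lambda>f. c * u f) w = c * g p u w"
  using metric_lincomb_left[OF assms(1,1,2), of c 0] by simp

lemma curvature_swap:
  assumes "X \<in> vector_fields A" "Y \<in> vector_fields A" "Z \<in> vector_fields A"
  shows "curvature D X Y Z = (\<lambda>p f. - curvature D Y X Z p f)"
proof -
  note c = connection_field[OF assms(1,2)] connection_field[OF assms(2,1)]
  show ?thesis
    by (simp add: curvature_def torsion_free[OF assms(1,2)] torsion_free[OF assms(2,1)]
        connection_diff[OF c assms(3)] connection_diff[OF c(2,1) assms(3)] algebra_simps)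
qed

lemma curvature_add_left:
  assumes "X \<in> vector_fields A" "X' \<in> vector_fields A" "Y \<in> vector_fields A" "Z \<in> vector_fields A"
  shows "curvature D (\<lambda>p f. X p f + X' p f) Y Z = (\<lambda>p f. curvature D X Y Z p f + curvature D X' Y Z p f)"
proof -
  note c = connection_field
  have "bracket (\<lambda>p f. X p f + X' p f) Y = (\<lambda>p f. bracket X Y p f + bracket X' Y p f)"
    using assms by (simp add: torsion_free vector_fields_add[OF atlas] connection_add algebra_simps)
  then show ?thesis
    using assms by (simp add: curvature_def connection_add c bracket_field algebra_simps)
qed

text \<open>The derivative of \<open>h\<close> produced by \<open>D Y (h * D X Z)\<close> cancels
  against the one in \<open>[hX, Y] = h [X, Y] - (Y h) X\<close>.\<close>

lemma curvature_smult_left: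
  assumes h: "h \<in> smooth_functions A" and "X \<in> vector_fields A" "Y \<in> vector_fields A" "Z \<in> vector_fields A"
  shows "curvature D (\<lambda>p f. h p * X p f) Y Z = (\<lambda>p f. h p * curvature D X Y Z p f)"
proof -
  \<comment> \<open>The coefficient of \<open>X\<close> in the bracket of \<open>h X\<close> with
    \<open>Y\<close>.\<close>
  let ?k = "\<lambda>p. - 1 * Y p h"
  have k: "?k \<in> smooth_functions A"
    using smooth_functions_mult[OF atlas smooth_functions_const vector_fields_smooth[OF assms(3) h]] .
  have b: "bracket X Y \<in> vector_fields A"
    using assms bracket_field by simp
  have "bracket (\<lambda>p f. h p * X p f) Y = (\<lambda>p f. h p * bracket X Y p f + ?k p * X p f)"
    using assms by (simp add: torsion_free vector_fields_smult[OF atlas] connection_smult algebra_simps)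
  then have "D (bracket (\<lambda>p f. h p * X p f) Y) Z = (\<lambda>p f. h p * D (bracket X Y) Z p f + ?k p * D X Z p f)"
    using connection_add(1)[OF vector_fields_smult[OF atlas h b] vector_fields_smult[OF atlas k assms(2)] assms(4)]
      connection_smult(1)[OF h b assms(4)] connection_smult(1)[OF k assms(2,4)] by simp
  then show ?thesis
    using assms by (simp add: curvature_def connection_smult connection_field algebra_simps)
qed

lemma curvature_add_right:
  assumes "X \<in> vector_fields A" "Y \<in> vector_fields A" "Z \<in> vector_fields A" "Z' \<in> vector_fields A"
  shows "curvature D X Y (\<lambda>p f. Z p f + Z' p f) = (\<lambda>p f. curvature D X Y Z p f + curvature D X Y Z' p f)"
  using assms by (simp add: curvature_def connection_add connection_field bracket_field algebra_simps)

text \<open>The terms with one derivative of \<open>h\<close> and one of \<open>Z\<close> are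
  symmetric in \<open>X\<close> and \<open>Y\<close> and cancel. The second derivatives of
  \<open>h\<close> leave \<open>X(Y h) - Y(X h)\<close>, which the bracket term removes.\<close>

lemma curvature_smult_right:
  assumes h: "h \<in> smooth_functions A" and "X \<in> vector_fields A" "Y \<in> vector_fields A" "Z \<in> vector_fields A"
  shows "curvature D X Y (\<lambda>p f. h p * Z p f) = (\<lambda>p f. h p * curvature D X Y Z p f)"
proof -
  have DD: "D V (D W (\<lambda>p f. h p * Z p f)) = (\<lambda>p f.
      (V p (\<lambda>q. W q h) * Z p f + W p h * D V Z p f) + (V p h * D W Z p f + h p * D V (D W Z) p f))"
    if "V \<in> vector_fields A" "W \<in> vector_fields A" for V W
  proof -
    have W: "(\<lambda>q. W q h) \<in> smooth_functions A"
      using vector_fields_smooth[OF that(2) h] .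
    note c = connection_field[OF that(2) assms(4)]
    show ?thesis
      using connection_add(2)[OF that(1) vector_fields_smult[OF atlas W assms(4)] vector_fields_smult[OF atlas h c]]
        connection_smult(2)[OF W that(1) assms(4)] connection_smult(2)[OF h that(1) c]
        connection_smult(2)[OF h that(2) assms(4)]
      by simp
  qed
  have b: "bracket X Y p h = X p (\<lambda>q. Y q h) - Y p (\<lambda>q. X q h)" for p
    by (simp add: bracket_def)
  show ?thesis
    by (simp add: b curvature_def DD[OF assms(2,3)] DD[OF assms(3,2)] algebra_simps
        connection_smult(2)[OF h bracket_field[OF assms(2,3)] assms(4)])
qed

lemma curvature_field:
  assumes "X \<in> vector_fields A" "Y \<in> vector_fields A" "Z \<in> vector_fields A"
  shows "curvature D X Y Z \<in> vector_fields A"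
  unfolding curvature_def
  using assms by (intro vector_fields_diff connection_field bracket_field)

lemma curvature4_swap:
  assumes "X \<in> vector_fields A" "Y \<in> vector_fields A" "Z \<in> vector_fields A" "W \<in> vector_fields A"
  shows "curvature4 g D X Y Z W p = - curvature4 g D Y X Z W p"
  using metric_smult_left[OF vector_fields_tangent[OF curvature_field[OF assms(2,1,3)]]
      vector_fields_tangent[OF assms(4)], where c = "- 1"]
  by (simp add: curvature4_def metric_on_fields_def curvature_swap[OF assms(1-3)])

lemma tensorial_at_metric_left:
  assumes "\<And>X Y. X \<in> vector_fields A \<Longrightarrow> Y \<in> vector_fields A
      \<Longrightarrow> T (\<lambda>p f. X p f + Y p f) = (\<lambda>p f. T X p f + T Y p f)"
    and "\<And>h X. h \<in> smooth_functions A \<Longrightarrow> X \<in> vector_fields A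
      \<Longrightarrow> T (\<lambda>p f. h p * X p f) = (\<lambda>p f. h p * T X p f)"
    and "\<And>X. X \<in> vector_fields A \<Longrightarrow> T X \<in> vector_fields A" and "w \<in> tangent_space A p"
  shows "tensorial_at p (\<lambda>X. g p (T X p) w)"
  unfolding tensorial_at_def
  using assms(4) by (simp add: assms(1-3) metric_add_left metric_smult_left vector_fields_tangent)

lemma tensorial_at_metric_right:
  assumes "w \<in> tangent_space A p"
  shows "tensorial_at p (\<lambda>X. g p w (X p))"
proof -
  have "tensorial_at p (\<lambda>X. g p (X p) w)"
    using assms by (intro tensorial_at_metric_left[where T = "\<lambda>X. X"]) simp_all
  then show ?thesis
    using assms unfolding tensorial_at_def
    by (simp add: metric_sym[OF assms] vector_fields_tangent vector_fields_add[OF atlas, THEN vector_fields_tangent]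
      vector_fields_smult[OF atlas, THEN vector_fields_tangent])
qed

lemma tensorial_at_uminus: "tensorial_at p F \<Longrightarrow> tensorial_at p (\<lambda>X. - F X)"
  by (simp add: tensorial_at_def)

text \<open>Covers the first, third and fourth slots; the second is reached from the first through
  \<open>curvature4_swap\<close>.\<close>

lemma curvature4_tensorial:
  shows "\<lbrakk>Y \<in> vector_fields A; Z \<in> vector_fields A; W \<in> vector_fields A\<rbrakk>
      \<Longrightarrow> tensorial_at p (\<lambda>X. curvature4 g D X Y Z W p)"
    and "\<lbrakk>X \<in> vector_fields A; Y \<in> vector_fields A; W \<in> vector_fields A\<rbrakk>
      \<Longrightarrow> tensorial_at p (\<lambda>Z. curvature4 g D X Y Z W p)"
    and "\<lbrakk>X \<in> vector_fields A; Y \<in> vector_fields A; Z \<in> vector_fields A\<rbrakk>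
      \<Longrightarrow> tensorial_at p (\<lambda>W. curvature4 g D X Y Z W p)"
  unfolding curvature4_def metric_on_fields_def
  by (intro tensorial_at_uminus tensorial_at_metric_left tensorial_at_metric_right vector_fields_tangent
      curvature_add_left curvature_smult_left curvature_add_right curvature_smult_right curvature_field;
      assumption)+

lemma curvature4_cong:
  assumes "X \<in> vector_fields A" "Y \<in> vector_fields A" "Z \<in> vector_fields A" "W \<in> vector_fields A"
    and "X' \<in> vector_fields A" "Y' \<in> vector_fields A" "Z' \<in> vector_fields A" "W' \<in> vector_fields A"
    and "X p = X' p" "Y p = Y' p" "Z p = Z' p" "W p = W' p"
  shows "curvature4 g D X Y Z W p = curvature4 g D X' Y' Z' W' p"
proof -
  note tc = tensorial_at_cong[OF curvature4_tensorial(1)] tensorial_at_cong[OF curvature4_tensorial(2)]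
    tensorial_at_cong[OF curvature4_tensorial(3)]
  have "curvature4 g D X Y Z W p = curvature4 g D X' Y Z W p"
    by (rule tc(1)[OF assms(2-4) assms(1,5,9)])
  also have "\<dots> = - curvature4 g D Y X' Z W p"
    by (rule curvature4_swap[OF assms(5,2-4)])
  also have "curvature4 g D Y X' Z W p = curvature4 g D Y' X' Z W p"
    by (rule tc(1)[OF assms(5,3,4) assms(2,6,10)])
  also have "- \<dots> = curvature4 g D X' Y' Z W p"
    by (rule curvature4_swap[OF assms(5,6,3,4), symmetric])
  also have "\<dots> = curvature4 g D X' Y' Z' W p"
    by (rule tc(2)[OF assms(5,6,4) assms(3,7,11)])
  also have "\<dots> = curvature4 g D X' Y' Z' W' p"
    by (rule tc(3)[OF assms(5-7) assms(4,8,12)])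
  finally show ?thesis .
qed

section \<open>The Lie derivative of the metric\<close>

text \<open>Metric compatibility expands the derivative along \<open>V\<close>, and torsion-freeness
  cancels the terms \<open>D V X\<close> and \<open>D V Y\<close>. What remains involves
  \<open>X\<close> and \<open>Y\<close> only through slots in which it is tensorial.\<close>

lemma lie_derivative_metric_eq:
  assumes "V \<in> vector_fields A" "X \<in> vector_fields A" "Y \<in> vector_fields A"
  shows "lie_derivative_metric g V X Y p = g p (D X V p) (Y p) + g p (X p) (D Y V p)"
proof -
  note c = connection_field[OF assms(1,2)] connection_field[OF assms(2,1)]
    connection_field[OF assms(1,3)] connection_field[OF assms(3,1)]
  note t = vector_fields_tangent
  have "g p (X p) (\<lambda>f. D V Y p f - D Y V p f) = g p (X p) (D V Y p) - g p (X p) (D Y V p)"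
    using metric_lincomb_right[OF t[OF c(3)] t[OF c(4)] t[OF assms(2)], where a = 1 and b = "- 1"] by simp
  then show ?thesis
    using metric_compatible[OF assms, of p]
    by (simp add: lie_derivative_metric_def torsion_free[OF assms(1,2)]
        torsion_free[OF assms(1,3)] metric_on_fields_def metric_diff_left[OF c(1,2) t[OF assms(3)]])
qed

lemma lie_derivative_metric_cong:
  assumes "V \<in> vector_fields A" "X \<in> vector_fields A" "Y \<in> vector_fields A"
    and "X' \<in> vector_fields A" "Y' \<in> vector_fields A" "X p = X' p" "Y p = Y' p"
  shows "lie_derivative_metric g V X Y p = lie_derivative_metric g V X' Y' p"
proof -
  have *: "g p (D X V p) w = g p (D X' V p) w"
    if "X \<in> vector_fields A" "X' \<in> vector_fields A" "X p = X' p" "w \<in> tangent_space A p" for X X' w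
  proof -
    have "tensorial_at p (\<lambda>X. g p (D X V p) w)"
      using assms(1) that(4) by (intro tensorial_at_metric_left connection_add connection_smult connection_field)
    then show ?thesis using tensorial_at_cong that by blast
  qed
  show ?thesis
    using assms *[OF assms(2,4,6)] *[OF assms(3,5,7)]
    by (simp add: lie_derivative_metric_eq vector_fields_tangent connection_field
        metric_sym[of _ p "D _ V p"])
qed

section \<open>Constant-coefficient fields and the Koszul formula\<close>

lemma connection_comb_left:
  assumes "Y \<in> vector_fields A"
  shows "D (comb a b c) Y = (\<lambda>p f. a * D e1 Y p f + b * D e2 Y p f + c * D e3 Y p f)"
proof -
  note f = vector_fields_smult[OF atlas smooth_functions_const frame_fields(1), of a]
    vector_fields_smult[OF atlas smooth_functions_const frame_fields(2), of b]
    vector_fields_smult[OF atlas smooth_functions_const frame_fields(3), of c]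
  show ?thesis
    unfolding comb_def
    by (simp add: connection_add(1)[OF vector_fields_add[OF atlas f(1,2)] f(3) assms]
        connection_add(1)[OF f(1,2) assms] connection_smult(1)[OF smooth_functions_const _ assms] frame_fields)
qed

lemma connection_comb_right:
  assumes "X \<in> vector_fields A"
  shows "D X (comb a b c) = (\<lambda>p f. a * D X e1 p f + b * D X e2 p f + c * D X e3 p f)"
proof -
  note f = vector_fields_smult[OF atlas smooth_functions_const frame_fields(1), of a]
    vector_fields_smult[OF atlas smooth_functions_const frame_fields(2), of b]
    vector_fields_smult[OF atlas smooth_functions_const frame_fields(3), of c]
  show ?thesis
    unfolding comb_def
    by (simp add: connection_add(2)[OF assms vector_fields_add[OF atlas f(1,2)] f(3)]
        connection_add(2)[OF assms f(1,2)] connection_smult(2)[OF smooth_functions_const assms] frame_fields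
        tangent_const[OF vector_fields_tangent[OF assms]])
qed

text \<open>Inner products of constant-coefficient fields are constant, so the derivative terms of
  the Koszul formula vanish and only brackets remain.\<close>

lemma koszul_comb:
  assumes X: "X = comb x1 x2 x3" and Y: "Y = comb y1 y2 y3" and Z: "Z = comb z1 z2 z3"
  shows "2 * g p (D X Y p) (Z p)
    = g p (bracket X Y p) (Z p) - g p (bracket Y Z p) (X p) + g p (bracket Z X p) (Y p)"
proof -
  have f: "X \<in> vector_fields A" "Y \<in> vector_fields A" "Z \<in> vector_fields A"
    by (simp_all add: X Y Z comb_field)
  note t = f[THEN vector_fields_tangent, of p]
  \<comment> \<open>Compatibility with a constant inner product says that \<open>D U\<close> is
    skew-adjoint on the three fields.\<close>
  have compat: "g p (D U V p) (W p) + g p (V p) (D U W p) = 0"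
    if "U \<in> {X, Y, Z}" "V \<in> {X, Y, Z}" "W \<in> {X, Y, Z}" for U V W
  proof -
    have U: "U \<in> vector_fields A" and "V \<in> vector_fields A" "W \<in> vector_fields A"
      using that f by auto
    moreover have "\<exists>c. metric_on_fields g V W = (\<lambda>_. c)"
      using that by (auto simp: metric_on_fields_def X Y Z metric_comb_comb)
    ultimately show ?thesis
      using metric_compatible[of U V W p] tangent_const[OF vector_fields_tangent[OF U]]
      by (auto simp: metric_on_fields_def)
  qed
  have br: "g p (bracket U V p) (W p) = g p (D U V p) (W p) - g p (D V U p) (W p)"
    if "U \<in> {X, Y, Z}" "V \<in> {X, Y, Z}" "W \<in> {X, Y, Z}" for U V W
  proof -
    have "U \<in> vector_fields A" "V \<in> vector_fields A" "W \<in> vector_fields A"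
      using that f by auto
    then show ?thesis
      using metric_diff_left[OF connection_field connection_field vector_fields_tangent, of U V V U W p]
      by (simp only: torsion_free)
  qed
  have sym: "g p (V p) (D U W p) = g p (D U W p) (V p)"
    if "U \<in> {X, Y, Z}" "V \<in> {X, Y, Z}" "W \<in> {X, Y, Z}" for U V W
    using that f by (auto intro!: metric_sym vector_fields_tangent connection_field)
  show ?thesis
    using compat[of X Y Z] compat[of Y X Z] compat[of Z X Y] by (simp add: br sym)
qed

text \<open>Testing the Koszul formula against the frame gives all coefficients of
  \<open>D X Y\<close>. The third condition carries \<open>- 2 * c\<close> because pairing with
  \<open>e3\<close> gives \<open>- c\<close>.\<close>

lemma connection_eq_comb:
  assumes "X = comb x1 x2 x3" "Y = comb y1 y2 y3"
    and "\<And>p. g p (bracket X Y p) (e1 p) - g p (bracket Y e1 p) (X p) + g p (bracket e1 X p) (Y p) = 2 * a"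
    and "\<And>p. g p (bracket X Y p) (e2 p) - g p (bracket Y e2 p) (X p) + g p (bracket e2 X p) (Y p) = 2 * b"
    and "\<And>p. g p (bracket X Y p) (e3 p) - g p (bracket Y e3 p) (X p) + g p (bracket e3 X p) (Y p) = - 2 * c"
  shows "D X Y = comb a b c"
proof
  fix p
  have "D X Y \<in> vector_fields A"
    using assms(1,2) by (simp add: connection_field comb_field)
  from field_expansion[OF this, of p] show "D X Y p = comb a b c p"
    using koszul_comb[OF assms(1,2) comb_frame(1)[symmetric], of p] assms(3)[of p]
      koszul_comb[OF assms(1,2) comb_frame(2)[symmetric], of p] assms(4)[of p]
      koszul_comb[OF assms(1,2) comb_frame(3)[symmetric], of p] assms(5)[of p]
    by simp
qed

lemma bracket_swap:
  "X \<in> vector_fields A \<Longrightarrow> Y \<in> vector_fields A \<Longrightarrow> bracket Y X = (\<lambda>p f. - bracket X Y p f)"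
  by (simp add: torsion_free)

end

section \<open>The group \<open>G\<^sub>1\<close>\<close>

locale g1_frame = lorentz_frame +
  fixes \<alpha> \<beta> :: real
  assumes bracket12: "bracket e1 e2 = (\<lambda>p f. \<alpha> * e1 p f - \<beta> * e3 p f)"
    and bracket13: "bracket e1 e3 = (\<lambda>p f. - \<alpha> * e1 p f - \<beta> * e2 p f)"
    and bracket23: "bracket e2 e3 = (\<lambda>p f. \<beta> * e1 p f + \<alpha> * e2 p f + \<alpha> * e3 p f)"
begin

section \<open>Brackets, connection and curvature in coefficients\<close>

lemma bracket_table:
  "bracket e1 e1 = comb 0 0 0" "bracket e2 e2 = comb 0 0 0" "bracket e3 e3 = comb 0 0 0"
  "bracket e1 e2 = comb \<alpha> 0 (- \<beta>)" "bracket e2 e1 = comb (- \<alpha>) 0 \<beta>"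
  "bracket e1 e3 = comb (- \<alpha>) (- \<beta>) 0" "bracket e3 e1 = comb \<alpha> \<beta> 0"
  "bracket e2 e3 = comb \<beta> \<alpha> \<alpha>" "bracket e3 e2 = comb (- \<beta>) (- \<alpha>) (- \<alpha>)"
  using bracket12 bracket13 bracket23
    bracket_swap[OF frame_fields(1,2)] bracket_swap[OF frame_fields(1,3)] bracket_swap[OF frame_fields(2,3)]
  by (simp_all add: comb_def torsion_free[OF frame_fields(1,1)] torsion_free[OF frame_fields(2,2)]
      torsion_free[OF frame_fields(3,3)] algebra_simps)

lemma connection_table:
  "D e1 e1 = comb 0 (- \<alpha>) (- \<alpha>)" "D e1 e2 = comb \<alpha> 0 (- \<beta> / 2)" "D e1 e3 = comb (- \<alpha>) (- \<beta> / 2) 0"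
  "D e2 e1 = comb 0 0 (\<beta> / 2)" "D e2 e2 = comb 0 0 \<alpha>" "D e2 e3 = comb (\<beta> / 2) \<alpha> 0"
  "D e3 e1 = comb 0 (\<beta> / 2) 0" "D e3 e2 = comb (- \<beta> / 2) 0 (- \<alpha>)" "D e3 e3 = comb 0 (- \<alpha>) 0"
  by (rule connection_eq_comb[OF comb_frame(1)[symmetric] comb_frame(1)[symmetric]]
        connection_eq_comb[OF comb_frame(1)[symmetric] comb_frame(2)[symmetric]]
        connection_eq_comb[OF comb_frame(1)[symmetric] comb_frame(3)[symmetric]]
        connection_eq_comb[OF comb_frame(2)[symmetric] comb_frame(1)[symmetric]]
        connection_eq_comb[OF comb_frame(2)[symmetric] comb_frame(2)[symmetric]]
        connection_eq_comb[OF comb_frame(2)[symmetric] comb_frame(3)[symmetric]]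
        connection_eq_comb[OF comb_frame(3)[symmetric] comb_frame(1)[symmetric]]
        connection_eq_comb[OF comb_frame(3)[symmetric] comb_frame(2)[symmetric]]
        connection_eq_comb[OF comb_frame(3)[symmetric] comb_frame(3)[symmetric]],
      simp_all add: bracket_table metric_comb_frame)+

lemma connection_comb:
  "D (comb x1 x2 x3) (comb y1 y2 y3) = comb
     (\<alpha> * x1 * y2 - \<alpha> * x1 * y3 + \<beta> / 2 * x2 * y3 - \<beta> / 2 * x3 * y2)
     (- \<alpha> * x1 * y1 - \<beta> / 2 * x1 * y3 + \<alpha> * x2 * y3 + \<beta> / 2 * x3 * y1 - \<alpha> * x3 * y3)
     (- \<alpha> * x1 * y1 - \<beta> / 2 * x1 * y2 + \<beta> / 2 * x2 * y1 + \<alpha> * x2 * y2 - \<alpha> * x3 * y2)"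
  by (simp add: connection_comb_left[OF comb_field] connection_comb_right[OF frame_fields(1)]
      connection_comb_right[OF frame_fields(2)] connection_comb_right[OF frame_fields(3)]
      connection_table) (simp add: comb_def fun_eq_iff algebra_simps)

lemma comb_diff: "comb a b c p f - comb x y z p f = comb (a - x) (b - y) (c - z) p f"
  by (simp add: comb_def algebra_simps)

lemma bracket_comb:
  "bracket (comb x1 x2 x3) (comb y1 y2 y3) = comb
     (\<alpha> * (x1 * y2 - x2 * y1) - \<alpha> * (x1 * y3 - x3 * y1) + \<beta> * (x2 * y3 - x3 * y2))
     (- \<beta> * (x1 * y3 - x3 * y1) + \<alpha> * (x2 * y3 - x3 * y2))
     (- \<beta> * (x1 * y2 - x2 * y1) + \<alpha> * (x2 * y3 - x3 * y2))"
  by (simp add: torsion_free comb_field connection_comb comb_diff) (simp add: algebra_simps)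

text \<open>The minors \<open>u\<close>, \<open>v\<close>, \<open>w\<close> are the coordinates of
  the bivector of the first two arguments; their cofactors are the matrices of
  \<open>R(e1,e2)\<close>, \<open>R(e1,e3)\<close> and \<open>R(e2,e3)\<close> acting on the
  third.\<close>

lemma curvature_comb:
  fixes x1 x2 x3 y1 y2 y3 z1 z2 z3 :: real
  defines "u \<equiv> x1 * y2 - x2 * y1" and "v \<equiv> x1 * y3 - x3 * y1" and "w \<equiv> x2 * y3 - x3 * y2"
  shows "curvature D (comb x1 x2 x3) (comb y1 y2 y3) (comb z1 z2 z3) = comb
     (u * (- (2 * \<alpha>\<^sup>2 + \<beta>\<^sup>2 / 4) * z2 + 2 * \<alpha>\<^sup>2 * z3) + v * (2 * \<alpha>\<^sup>2 * z2 + (\<beta>\<^sup>2 / 4 - 2 * \<alpha>\<^sup>2) * z3)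
        + w * (\<alpha> * \<beta> * z3 - \<alpha> * \<beta> * z2))
     (u * ((2 * \<alpha>\<^sup>2 + \<beta>\<^sup>2 / 4) * z1 - \<alpha> * \<beta> * z3) + v * (\<alpha> * \<beta> * z3 - 2 * \<alpha>\<^sup>2 * z1)
        + w * (\<alpha> * \<beta> * z1 + \<beta>\<^sup>2 / 4 * z3))
     (u * (2 * \<alpha>\<^sup>2 * z1 - \<alpha> * \<beta> * z2) + v * ((\<beta>\<^sup>2 / 4 - 2 * \<alpha>\<^sup>2) * z1 + \<alpha> * \<beta> * z2)
        + w * (\<alpha> * \<beta> * z1 + \<beta>\<^sup>2 / 4 * z2))"
  unfolding curvature_def bracket_comb connection_comb comb_diff u_def v_def w_def
  by (intro arg_cong3[where f = comb]) (simp_all add: field_simps power2_eq_square)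

text \<open>The \<beta>-part of the covariant derivative of the field is skew-adjoint and drops out
  on symmetrising, so every coefficient has a factor \<alpha>.\<close>

lemma lie_derivative_comb:
  "lie_derivative_metric g (comb l1 l2 l3) (comb x1 x2 x3) (comb y1 y2 y3) p
    = 2 * \<alpha> * (l2 - l3) * x1 * y1 - \<alpha> * l1 * (x1 * y2 + x2 * y1) + \<alpha> * l1 * (x1 * y3 + x3 * y1)
      + 2 * \<alpha> * l3 * x2 * y2 - \<alpha> * (l2 + l3) * (x2 * y3 + x3 * y2) + 2 * \<alpha> * l2 * x3 * y3"
  by (simp add: lie_derivative_metric_eq comb_field connection_comb metric_comb_comb)
    (simp add: field_simps)

section \<open>Solving the soliton equation\<close>

lemma riemann_soliton_iff:
  assumes "\<alpha> \<noteq> 0" "e1 \<in> left_invariant_fields A mul" "e2 \<in> left_invariant_fields A mul" "e3 \<in> left_invariant_fields A mul"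
  shows "left_invariant_riemann_soliton A mul g D (comb l1 l2 l3) l \<longleftrightarrow>
           l1 = 2 * \<beta> \<and> l2 = - 2 * \<alpha> \<and> l3 = - 2 * \<alpha> \<and> l = \<beta>\<^sup>2 / 4"
    (is "?soliton \<longleftrightarrow> ?values")
proof -
  let ?V = "comb l1 l2 l3"
  let ?defect = "\<lambda>X Y Z W p. curvature4 g D X Y Z W p
    + 1/2 * kulkarni_nomizu (lie_derivative_metric g ?V) (metric_on_fields g) X Y Z W p
    - l/2 * kulkarni_nomizu (metric_on_fields g) (metric_on_fields g) X Y Z W p"
  note eqs = curvature4_def metric_on_fields_def curvature_comb metric_comb_comb
    kulkarni_nomizu_def lie_derivative_comb
  show ?thesis
  proof
    assume ?soliton
    \<comment> \<open>On constant-coefficient fields both sides are constant functions, so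
      evaluation at an arbitrary point loses nothing.\<close>
    then have *: "?defect (comb x1 x2 x3) (comb y1 y2 y3) (comb z1 z2 z3) (comb w1 w2 w3) undefined = 0"
      for x1 x2 x3 y1 y2 y3 z1 z2 z3 w1 w2 w3
      unfolding left_invariant_riemann_soliton_def using comb_field by simp
    \<comment> \<open>The diagonal components \<open>(e1,e2,e1,e2)\<close>,
      \<open>(e1,e3,e1,e3)\<close> and \<open>(e2,e3,e2,e3)\<close> follow in this order, then the
      off-diagonal \<open>(e1,e2,e2,e3)\<close>.\<close>
    have "4 * \<alpha>\<^sup>2 + 2 * \<alpha> * l2 + \<beta>\<^sup>2 / 2 = 2 * l"
      using *[of 1 0 0 0 1 0 1 0 0 0 1 0] by (simp add: eqs field_simps)
    moreover have "4 * \<alpha>\<^sup>2 + 2 * \<alpha> * l3 - \<beta>\<^sup>2 / 2 = - 2 * l"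
      using *[of 1 0 0 0 0 1 1 0 0 0 0 1] by (simp add: eqs field_simps)
    moreover have "2 * \<alpha> * l3 - 2 * \<alpha> * l2 + \<beta>\<^sup>2 / 2 = 2 * l"
      using *[of 0 1 0 0 0 1 0 1 0 0 0 1] by (simp add: eqs field_simps)
    moreover have "\<alpha> * l1 = \<alpha> * (2 * \<beta>)"
      using *[of 1 0 0 0 1 0 0 1 0 0 0 1] by (simp add: eqs field_simps)
    \<comment> \<open>The first equation minus the second plus the third gives
      \<open>6 * l = 3 * \<beta>\<^sup>2 / 2\<close>; the first two then yield
      \<open>\<alpha> * l2\<close> and \<open>\<alpha> * l3\<close>. Cancelling \<alpha>, which is
      nonzero, finishes this direction.\<close>
    ultimately have "l = \<beta>\<^sup>2 / 4" "\<alpha> * l2 = \<alpha> * (- 2 * \<alpha>)" "\<alpha> * l3 = \<alpha> * (- 2 * \<alpha>)"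
        "\<alpha> * l1 = \<alpha> * (2 * \<beta>)"
      by (simp_all add: power2_eq_square)
    then show ?values
      using assms(1) by (metis mult_left_cancel)
  next
    assume ?values
    then have vals: "l1 = 2 * \<beta>" "l2 = - 2 * \<alpha>" "l3 = - 2 * \<alpha>" "l = \<beta>\<^sup>2 / 4"
      by simp_all
    have "?V \<in> left_invariant_fields A mul"
      using assms(2-) comb_field[of l1 l2 l3]
      by (simp add: left_invariant_fields_def comb_def push_left_def)
    moreover have "?defect X Y Z W p = 0"
      if f: "X \<in> vector_fields A" "Y \<in> vector_fields A" "Z \<in> vector_fields A" "W \<in> vector_fields A" for X Y Z W p
    proof -
      \<comment> \<open>Each field agrees at \<open>p\<close> with a constant-coefficient one. Both
        tensors see only values at \<open>p\<close>, so the defect may be computed on these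
        replacements.\<close>
      obtain x1 x2 x3 y1 y2 y3 z1 z2 z3 w1 w2 w3 where
        e: "X p = comb x1 x2 x3 p" "Y p = comb y1 y2 y3 p" "Z p = comb z1 z2 z3 p" "W p = comb w1 w2 w3 p"
        using field_expansion f by blast
      note L = lie_derivative_metric_cong[OF comb_field _ _ comb_field comb_field]
      have "?defect X Y Z W p
        = ?defect (comb x1 x2 x3) (comb y1 y2 y3) (comb z1 z2 z3) (comb w1 w2 w3) p"
        unfolding kulkarni_nomizu_def metric_on_fields_def
          curvature4_cong[OF f comb_field comb_field comb_field comb_field e]
          L[OF f(1,3) e(1,3)] L[OF f(1,4) e(1,4)] L[OF f(2,3) e(2,3)] L[OF f(2,4) e(2,4)] e
        by (rule refl)
      also have "\<dots> = 0"
        \<comment> \<open>With the four values inserted, the defect is a polynomial in the twelve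
          coefficients, \<alpha> and \<beta> that vanishes identically.\<close>
        unfolding eqs vals by (simp add: field_simps power2_eq_square)
      finally show ?thesis .
    qed
    ultimately show ?soliton
      unfolding left_invariant_riemann_soliton_def by simp
  qed
qed

end

theorem theorem2p1:
  fixes A :: "('a::{t2_space,second_countable_topology}, 3) chart set"
    and mul :: "'a \<Rightarrow> 'a \<Rightarrow> 'a" and one :: 'a and inve :: "'a \<Rightarrow> 'a"
    and g :: "'a metric" and D :: "'a connection"
    and e1 e2 e3 V :: "'a vfield"
    and \<alpha> \<beta> l1 l2 l3 l :: real
  assumes "\<alpha> \<noteq> 0"
    and "lie_group A mul one inve"
    and "connected (UNIV :: 'a set)" and "simply_connected (UNIV :: 'a set)"
    and "lorentzian_metric A g" and "left_invariant_metric A mul g"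
    and "levi_civita_connection A g D"
    and "pseudo_orthonormal_basis A mul g e1 e2 e3"
    and "bracket e1 e2 = (\<lambda>p f. \<alpha> * e1 p f - \<beta> * e3 p f)"
    and "bracket e1 e3 = (\<lambda>p f. - \<alpha> * e1 p f - \<beta> * e2 p f)"
    and "bracket e2 e3 = (\<lambda>p f. \<beta> * e1 p f + \<alpha> * e2 p f + \<alpha> * e3 p f)"
    and "V = (\<lambda>p f. l1 * e1 p f + l2 * e2 p f + l3 * e3 p f)"
  shows "left_invariant_riemann_soliton A mul g D V l \<longleftrightarrow>
           l1 = 2 * \<beta> \<and> l2 = - 2 * \<alpha> \<and> l3 = - 2 * \<alpha> \<and> l = \<beta>\<^sup>2 / 4"
proof -
  have e: "e1 \<in> left_invariant_fields A mul" "e2 \<in> left_invariant_fields A mul"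
      "e3 \<in> left_invariant_fields A mul"
    using assms(8) by (auto simp: pseudo_orthonormal_basis_def)
  \<comment> \<open>The atlas comes from \<open>lie_group\<close>, and the orthonormality relations
    from \<open>pseudo_orthonormal_basis\<close>; the frame fields are smooth because they are
    left-invariant fields.\<close>
  interpret g1_frame A g D e1 e2 e3 \<alpha> \<beta>
    using assms(2,5,7-11) e
    by unfold_locales
      (simp_all add: lie_group_def pseudo_orthonormal_basis_def left_invariant_fields_def)
  show ?thesis
    using riemann_soliton_iff[OF assms(1) e] unfolding assms(12) comb_def .
qed

end
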